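(* Let $x_1,x_2,x_3\in\mathbb R^3$ be the vertices of a nondegenerate triangle and let $x_4$ be a point with $r_{14}=r_{24}=r_{34}$ (an upright tetrahedron). Then $$\Re(D_4)-4\cdot 288V^2\ \ge\ 64\prod_{1\le i<j\le 4}r_{ij}+\sum_{l=1}^4\Bigl(4+\tfrac14\Bigr)r_{il}r_{jl}r_{kl}\,d_3(r_{ij},r_{ik},r_{jk}),$$ where for each $l$ one writes $\{1,2,3,4\}\setminus\{l\}=\{i<j<k\}$.
   Context: Put $d_3(a,b,c)=(a+b-c)(b+c-a)(c+a-b)$. For distinct points $x_1,\dots,x_4\in\mathbb R^3$ let $r_{ij}=|x_i-x_j|$, and let $V$ be the volume of the tetrahedron with these vertices ($V=0$ if coplanar). The (non-normalized) Atiyah determinant $D_4\in\mathbb C$ is defined as follows. Identify $S^2$ with $\mathbb{CP}^1=\mathbb C\cup\{\infty\}$ by stereographic projection, so that the antipode of $t$ is $-1/\bar t$. For $i\ne j$ let $t_{ij}$ be the point corresponding to the unit vector $(x_j-x_i)/r_{ij}$. For each pair $i<j$ choose a unit vector $(\alpha,\beta)\in\mathbb C^2$ such that $\ell_{ij}(t)=\alpha t+\beta$ has root $t_{ij}$ (with $\alpha=0$ if $t_{ij}=\infty$), and put $\ell_{ji}(t)=-\bar\beta t+\bar\alpha$ (which has root $t_{ji}$). Let $p_i(t)=\prod_{j\ne i}\ell_{ij}(t)=\sum_{j=1}^4 m_{ij}t^{j-1}$ and $D_4=64\prod_{1\le i<j\le4}r_{ij}\cdot\det(m_{ij})$; this does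 not depend on the choices. Known fact (Eastwood–Norbury): $$\Re(D_4)=64\prod_{i<j}r_{ij}-4d_3(r_{12}r_{34},r_{13}r_{24},r_{14}r_{23})+A_4+288V^2,$$ $$A_4=\sum_{l=1}^4\Bigl(\sum_{i\ne l}r_{li}\bigl((r_{lj}+r_{lk})^2-r_{jk}^2\bigr)\Bigr)d_3(r_{ij},r_{ik},r_{jk}),\qquad \{j,k\}=\{1,2,3,4\}\setminus\{l,i\}.$$ *)

theory Defs
  imports "HOL-Analysis.Analysis" "Jordan_Normal_Form.Determinant"
begin

(* vec_nth is written out in full because Jordan_Normal_Form also claims the infix dollar sign. *)

definition d3 :: "real \<Rightarrow> real \<Rightarrow> real \<Rightarrow> real" where
  "d3 a b c = (a + b - c) * (b + c - a) * (c + a - b)"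

(* Projection from the north pole (0,0,1) of the unit sphere onto the Riemann sphere, with None
   for infinity. For a unit vector u the image of - u is -1/cnj t, where t is the image of u. *)
definition stereographic :: "real ^ 3 \<Rightarrow> complex option" where
  "stereographic u =
    (if vec_nth u 3 = 1 then None
     else Some (Complex (vec_nth u 1) (vec_nth u 2) / complex_of_real (1 - vec_nth u 3)))"

definition direction_point :: "(nat \<Rightarrow> real ^ 3) \<Rightarrow> nat \<Rightarrow> nat \<Rightarrow> complex option" where
  "direction_point x i j = stereographic ((x j - x i) /\<^sub>R dist (x i) (x j))"

(* t is a root of the form a * t + b; infinity is a root iff the leading coefficient a vanishes. *)
definition linear_root :: "complex \<Rightarrow> complex \<Rightarrow> complex option \<Rightarrow> bool" where
  "linear_root a b t = (case t of None \<Rightarrow> a = 0 | Some z \<Rightarrow> a * z + b = 0)"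

(* Only the values at 1 \<le> i < j \<le> 4 are relevant. *)
definition admissible_lift ::
    "(nat \<Rightarrow> real ^ 3) \<Rightarrow> (nat \<Rightarrow> nat \<Rightarrow> complex) \<Rightarrow> (nat \<Rightarrow> nat \<Rightarrow> complex) \<Rightarrow> bool" where
  "admissible_lift x \<alpha> \<beta> \<longleftrightarrow>
    (\<forall>i\<in>{1..4}. \<forall>j\<in>{1..4}. i < j \<longrightarrow>
      (cmod (\<alpha> i j))\<^sup>2 + (cmod (\<beta> i j))\<^sup>2 = 1 \<and>
      linear_root (\<alpha> i j) (\<beta> i j) (direction_point x i j))"

definition atiyah_linear ::
    "(nat \<Rightarrow> nat \<Rightarrow> complex) \<Rightarrow> (nat \<Rightarrow> nat \<Rightarrow> complex) \<Rightarrow> nat \<Rightarrow> nat \<Rightarrow> complex poly" where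
  "atiyah_linear \<alpha> \<beta> i j =
    (if i < j then [:\<beta> i j, \<alpha> i j:] else [:cnj (\<alpha> j i), - cnj (\<beta> j i):])"

definition atiyah_poly ::
    "(nat \<Rightarrow> nat \<Rightarrow> complex) \<Rightarrow> (nat \<Rightarrow> nat \<Rightarrow> complex) \<Rightarrow> nat \<Rightarrow> complex poly" where
  "atiyah_poly \<alpha> \<beta> i = (\<Prod>j\<in>{1..4} - {i}. atiyah_linear \<alpha> \<beta> i j)"

(* Points are numbered from 1, whereas the rows and columns of mat are numbered from 0. *)
definition atiyah_matrix ::
    "(nat \<Rightarrow> nat \<Rightarrow> complex) \<Rightarrow> (nat \<Rightarrow> nat \<Rightarrow> complex) \<Rightarrow> complex mat" where
  "atiyah_matrix \<alpha> \<beta> = mat 4 4 (\<lambda>(i, j). coeff (atiyah_poly \<alpha> \<beta> (i + 1)) j)"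

definition edge_product :: "(nat \<Rightarrow> real ^ 3) \<Rightarrow> real" where
  "edge_product x = (\<Prod>j\<in>{1..4}. \<Prod>i\<in>{1..<j}. dist (x i) (x j))"

definition atiyah_D4 ::
    "(nat \<Rightarrow> real ^ 3) \<Rightarrow> (nat \<Rightarrow> nat \<Rightarrow> complex) \<Rightarrow> (nat \<Rightarrow> nat \<Rightarrow> complex) \<Rightarrow> complex" where
  "atiyah_D4 x \<alpha> \<beta> =
    64 * complex_of_real (edge_product x) * Determinant.det (atiyah_matrix \<alpha> \<beta>)"

definition tetrahedron_volume :: "(nat \<Rightarrow> real ^ 3) \<Rightarrow> real" where
  "tetrahedron_volume x = measure lborel (convex hull (x ` {1..4}))"

(* Admissible lifts always exist, so quantifying over them is never vacuous. *)
lemma admissible_lift_exists: "\<exists>\<alpha> \<beta>. admissible_lift x \<alpha> \<beta>"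
proof -
  have "\<exists>a b. (cmod a)\<^sup>2 + (cmod b)\<^sup>2 = 1 \<and> linear_root a b t" for t
  proof (cases t)
    case None
    have "(cmod 0)\<^sup>2 + (cmod 1)\<^sup>2 = 1 \<and> linear_root 0 1 t"
      by (simp add: None linear_root_def)
    then show ?thesis by blast
  next
    case (Some z)
    define s where "s = sqrt (1 + (cmod z)\<^sup>2)"
    have pos: "1 + (cmod z)\<^sup>2 > 0" by (simp add: add_pos_nonneg)
    then have s: "s > 0" "s\<^sup>2 = 1 + (cmod z)\<^sup>2" by (simp_all add: s_def)
    have "(cmod (1 / of_real s))\<^sup>2 + (cmod (- z / of_real s))\<^sup>2 = (1 + (cmod z)\<^sup>2) / s\<^sup>2"
      using s(1) by (simp add: norm_divide power_divide add_divide_distrib)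
    also have "\<dots> = 1" using s(2) pos by simp
    finally have "(cmod (1 / of_real s))\<^sup>2 + (cmod (- z / of_real s))\<^sup>2 = 1" .
    moreover have "linear_root (1 / of_real s) (- z / of_real s) t"
      by (simp add: Some linear_root_def)
    ultimately show ?thesis by blast
  qed
  then have "\<forall>i j. \<exists>a b. (cmod a)\<^sup>2 + (cmod b)\<^sup>2 = 1 \<and> linear_root a b (direction_point x i j)"
    by blast
  then obtain \<alpha> \<beta> where
    "\<forall>i j. (cmod (\<alpha> i j))\<^sup>2 + (cmod (\<beta> i j))\<^sup>2 = 1 \<and>
       linear_root (\<alpha> i j) (\<beta> i j) (direction_point x i j)"
    by metis
  then show ?thesis unfolding admissible_lift_def by blast
qed

end

(* The determinant contains, for each edge ij, one coefficient of l_ij and one of l_ji, so it is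
   linear in the products 2 r_ij (coefficient of l_ij)(coefficient of l_ji). By the choice of lifts
   these products do not depend on the phases: they are the entries of the Hermitian matrix
   r_ij + (x_j - x_i).sigma (sigma the Pauli matrices) up to order and signs. Hence D_4 is an
   explicit polynomial in the r_ij and the coordinates, and adding its conjugate yields the
   Eastwood-Norbury formula as a polynomial identity. For an upright tetrahedron the difference of
   the two sides of the theorem is a cubic polynomial in r = r_14 whose coefficients depend on the
   sides a, b, c of the base. The only inequalities needed are those of the triangle and
   2 r >= max(a, b, c): in the Ravi-type coordinates that resolve them all coefficients of the
   difference are nonnegative. *)

theory Submission
  imports Defs
begin

section \<open>The determinant as a multilinear form in the edges\<close>

text \<open>The entry at \<open>p q\<close> for the edge \<open>ij\<close> (\<open>i < j\<close>) stands for the coefficient of \<open>t\<^sup>p\<close> in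
  \<open>l\<^sub>i\<^sub>j\<close> times the coefficient of \<open>t\<^sup>q\<close> in \<open>l\<^sub>j\<^sub>i\<close>. The arguments of the form below are the
  edges 12, 13, 23, 14, 24, 34. Terms are grouped by the degrees that the edges of the triangle 123
  contribute to the first three rows.\<close>

type_synonym 'a edge_coeffs = "nat \<Rightarrow> nat \<Rightarrow> 'a"

definition edge_form :: "'a edge_coeffs \<Rightarrow> 'a edge_coeffs \<Rightarrow> 'a edge_coeffs \<Rightarrow>
    'a edge_coeffs \<Rightarrow> 'a edge_coeffs \<Rightarrow> 'a edge_coeffs \<Rightarrow> 'a :: comm_ring_1" where
  "edge_form a b c d e f =
    (a 0 0 * b 0 0 * c 0 1 + a 0 0 * b 0 1 * c 0 0) *
      (d 0 1 * e 1 1 * f 1 1 - d 1 1 * e 0 1 * f 1 1)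
    + a 0 0 * b 0 1 * c 0 1 *
      (d 0 1 * e 1 1 * f 0 1 + d 1 0 * e 0 1 * f 1 1 + d 1 1 * e 0 0 * f 1 1
        + d 1 1 * e 0 1 * f 1 0 - d 0 0 * e 1 1 * f 1 1 - d 0 1 * e 1 0 * f 1 1
        - d 0 1 * e 1 1 * f 1 0 - d 1 1 * e 0 1 * f 0 1)
    + (a 0 0 * b 0 0 * c 1 0 + a 0 1 * b 0 0 * c 0 0) *
      (d 1 1 * e 1 1 * f 0 1 - d 0 1 * e 1 1 * f 1 1)
    + (a 0 0 * b 0 0 * c 1 1 + a 0 0 * b 0 1 * c 1 0 + a 0 1 * b 0 0 * c 0 1
        + a 0 1 * b 0 1 * c 0 0) *
      (d 0 1 * e 0 1 * f 1 1 - d 0 1 * e 1 1 * f 0 1)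
    + (a 0 0 * b 0 1 * c 1 1 + a 0 1 * b 0 1 * c 0 1) *
      (d 0 0 * e 1 0 * f 1 1 + d 0 0 * e 1 1 * f 1 0 + d 0 1 * e 0 1 * f 0 1
        + d 0 1 * e 1 0 * f 1 0 - d 0 0 * e 0 1 * f 1 1 - d 0 1 * e 0 0 * f 1 1
        - d 0 1 * e 0 1 * f 1 0 - d 1 0 * e 1 0 * f 1 0)
    + a 0 1 * b 0 0 * c 1 0 *
      (d 0 0 * e 1 1 * f 1 1 + d 0 1 * e 1 0 * f 1 1 + d 0 1 * e 1 1 * f 1 0
        + d 1 1 * e 0 1 * f 0 1 - d 0 1 * e 0 1 * f 1 1 - d 1 0 * e 1 1 * f 0 1
        - d 1 1 * e 1 0 * f 0 1 - d 1 1 * e 1 1 * f 0 0)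
    + (a 0 1 * b 0 0 * c 1 1 + a 0 1 * b 0 1 * c 1 0) *
      (d 0 0 * e 1 1 * f 0 1 + d 0 1 * e 1 0 * f 0 1 + d 0 1 * e 1 1 * f 0 0
        + d 1 0 * e 1 0 * f 1 0 - d 0 0 * e 1 0 * f 1 1 - d 0 0 * e 1 1 * f 1 0
        - d 0 1 * e 0 1 * f 0 1 - d 0 1 * e 1 0 * f 1 0)
    + a 0 1 * b 0 1 * c 1 1 *
      (d 0 0 * e 0 0 * f 1 1 + d 0 0 * e 0 1 * f 1 0 + d 0 1 * e 0 0 * f 1 0
        + d 1 0 * e 1 0 * f 0 0 - d 0 0 * e 1 0 * f 0 1 - d 0 0 * e 1 1 * f 0 0
        - d 0 1 * e 1 0 * f 0 0 - d 1 0 * e 0 0 * f 1 0)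
    + (a 0 0 * b 1 0 * c 0 0 + a 1 0 * b 0 0 * c 0 0) *
      (d 1 1 * e 0 1 * f 1 1 - d 1 1 * e 1 1 * f 0 1)
    + (a 0 0 * b 1 0 * c 0 1 + a 0 0 * b 1 1 * c 0 0 + a 1 0 * b 0 0 * c 0 1
        + a 1 0 * b 0 1 * c 0 0) *
      (d 1 1 * e 0 1 * f 0 1 - d 0 1 * e 0 1 * f 1 1)
    + (a 0 0 * b 1 1 * c 0 1 + a 1 0 * b 0 1 * c 0 1) *
      (d 0 0 * e 0 1 * f 1 1 + d 0 1 * e 0 0 * f 1 1 + d 0 1 * e 0 1 * f 1 0
        + d 1 0 * e 1 0 * f 1 0 - d 0 1 * e 0 1 * f 0 1 - d 1 0 * e 0 0 * f 1 1
        - d 1 0 * e 0 1 * f 1 0 - d 1 1 * e 0 0 * f 1 0)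
    + (a 0 0 * b 1 0 * c 1 0 + a 0 1 * b 1 0 * c 0 0 + a 1 0 * b 0 0 * c 1 0
        + a 1 1 * b 0 0 * c 0 0) *
      (d 0 1 * e 1 1 * f 0 1 - d 1 1 * e 0 1 * f 0 1)
    + (a 0 0 * b 1 1 * c 1 1 + a 0 1 * b 1 1 * c 0 1 + a 1 0 * b 0 1 * c 1 1
        + a 1 1 * b 0 1 * c 0 1) *
      (d 1 0 * e 0 0 * f 1 0 - d 0 0 * e 1 0 * f 1 0)
    + (a 0 1 * b 1 0 * c 1 0 + a 1 1 * b 0 0 * c 1 0) *
      (d 0 1 * e 0 1 * f 0 1 + d 1 0 * e 1 0 * f 0 1 + d 1 0 * e 1 1 * f 0 0
        + d 1 1 * e 1 0 * f 0 0 - d 0 0 * e 1 1 * f 0 1 - d 0 1 * e 1 0 * f 0 1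
        - d 0 1 * e 1 1 * f 0 0 - d 1 0 * e 1 0 * f 1 0)
    + (a 0 1 * b 1 0 * c 1 1 + a 0 1 * b 1 1 * c 1 0 + a 1 1 * b 0 0 * c 1 1
        + a 1 1 * b 0 1 * c 1 0) *
      (d 0 0 * e 1 0 * f 1 0 - d 1 0 * e 1 0 * f 0 0)
    + (a 0 1 * b 1 1 * c 1 1 + a 1 1 * b 0 1 * c 1 1) *
      (d 0 0 * e 1 0 * f 0 0 - d 0 0 * e 0 0 * f 1 0)
    + a 1 0 * b 1 0 * c 0 0 *
      (d 0 1 * e 0 1 * f 1 1 + d 1 0 * e 1 1 * f 0 1 + d 1 1 * e 1 0 * f 0 1
        + d 1 1 * e 1 1 * f 0 0 - d 0 1 * e 1 1 * f 0 1 - d 1 0 * e 0 1 * f 1 1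
        - d 1 1 * e 0 0 * f 1 1 - d 1 1 * e 0 1 * f 1 0)
    + (a 1 0 * b 1 0 * c 0 1 + a 1 0 * b 1 1 * c 0 0) *
      (d 0 1 * e 0 1 * f 0 1 + d 1 0 * e 0 0 * f 1 1 + d 1 0 * e 0 1 * f 1 0
        + d 1 1 * e 0 0 * f 1 0 - d 1 0 * e 0 1 * f 0 1 - d 1 0 * e 1 0 * f 1 0
        - d 1 1 * e 0 0 * f 0 1 - d 1 1 * e 0 1 * f 0 0)
    + a 1 0 * b 1 1 * c 0 1 *
      (d 0 0 * e 1 0 * f 1 0 + d 1 0 * e 0 0 * f 0 1 + d 1 0 * e 0 1 * f 0 0
        + d 1 1 * e 0 0 * f 0 0 - d 0 0 * e 0 0 * f 1 1 - d 0 0 * e 0 1 * f 1 0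
        - d 0 1 * e 0 0 * f 1 0 - d 1 0 * e 1 0 * f 0 0)
    + (a 1 0 * b 1 0 * c 1 0 + a 1 1 * b 1 0 * c 0 0) *
      (d 1 0 * e 0 1 * f 0 1 + d 1 0 * e 1 0 * f 1 0 + d 1 1 * e 0 0 * f 0 1
        + d 1 1 * e 0 1 * f 0 0 - d 0 1 * e 0 1 * f 0 1 - d 1 0 * e 1 0 * f 0 1
        - d 1 0 * e 1 1 * f 0 0 - d 1 1 * e 1 0 * f 0 0)
    + (a 1 0 * b 1 0 * c 1 1 + a 1 0 * b 1 1 * c 1 0 + a 1 1 * b 1 0 * c 0 1
        + a 1 1 * b 1 1 * c 0 0) *
      (d 1 0 * e 1 0 * f 0 0 - d 1 0 * e 0 0 * f 1 0)
    + (a 1 0 * b 1 1 * c 1 1 + a 1 1 * b 1 1 * c 0 1) *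
      (d 0 0 * e 0 0 * f 1 0 - d 1 0 * e 0 0 * f 0 0)
    + a 1 1 * b 1 0 * c 1 0 *
      (d 0 0 * e 1 0 * f 0 1 + d 0 0 * e 1 1 * f 0 0 + d 0 1 * e 1 0 * f 0 0
        + d 1 0 * e 0 0 * f 1 0 - d 0 0 * e 1 0 * f 1 0 - d 1 0 * e 0 0 * f 0 1
        - d 1 0 * e 0 1 * f 0 0 - d 1 1 * e 0 0 * f 0 0)
    + (a 1 1 * b 1 0 * c 1 1 + a 1 1 * b 1 1 * c 1 0) *
      (d 1 0 * e 0 0 * f 0 0 - d 0 0 * e 1 0 * f 0 0)"

text \<open>Each monomial of the form contains exactly one entry of every edge. Hence the factor 64
  times the product of the edge lengths can be distributed as one factor 2 r_ij per edge.\<close>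

lemma edge_form_scale:
  "edge_form (\<lambda>p q. s1 * a p q) (\<lambda>p q. s2 * b p q) (\<lambda>p q. s3 * c p q)
      (\<lambda>p q. s4 * d p q) (\<lambda>p q. s5 * e p q) (\<lambda>p q. s6 * f p q) =
    (s1 * s2 * s3 * s4 * s5 * s6 :: complex) * edge_form a b c d e f"
  unfolding edge_form_def by (simp add: algebra_simps)

lemma edge_form_cong:
  assumes "\<And>p q. p \<le> 1 \<Longrightarrow> q \<le> 1 \<Longrightarrow> a p q = a' p q"
    "\<And>p q. p \<le> 1 \<Longrightarrow> q \<le> 1 \<Longrightarrow> b p q = b' p q"
    "\<And>p q. p \<le> 1 \<Longrightarrow> q \<le> 1 \<Longrightarrow> c p q = c' p q"
    "\<And>p q. p \<le> 1 \<Longrightarrow> q \<le> 1 \<Longrightarrow> d p q = d' p q"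
    "\<And>p q. p \<le> 1 \<Longrightarrow> q \<le> 1 \<Longrightarrow> e p q = e' p q"
    "\<And>p q. p \<le> 1 \<Longrightarrow> q \<le> 1 \<Longrightarrow> f p q = f' p q"
  shows "edge_form a b c d e f = edge_form a' b' c' d' e' f'"
  unfolding edge_form_def by (simp only: assms le_refl zero_le)

text \<open>The form has integer coefficients. For \<open>edge_tensor\<close> entries with real
  \<open>r\<close> and \<open>z\<close> and with \<open>v\<close> conjugate to \<open>w\<close>,
  conjugation therefore amounts to swapping \<open>w\<close> and \<open>v\<close>.\<close>

lemma cnj_edge_form:
  "cnj (edge_form a b c d e f) =
    edge_form (\<lambda>p q. cnj (a p q)) (\<lambda>p q. cnj (b p q)) (\<lambda>p q. cnj (c p q))
      (\<lambda>p q. cnj (d p q)) (\<lambda>p q. cnj (e p q)) (\<lambda>p q. cnj (f p q))"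
  unfolding edge_form_def complex_cnj_add complex_cnj_diff complex_cnj_mult by (rule refl)

lemma det_2_2:
  fixes B :: "'a :: comm_ring_1 mat"
  assumes "B \<in> carrier_mat 2 2"
  shows "Determinant.det B = B $$ (0, 0) * B $$ (1, 1) - B $$ (0, 1) * B $$ (1, 0)"
  using assms
  by (subst laplace_expansion_row[OF assms, of 0])
    (simp_all add: cofactor_def det_single mat_delete_def lessThan_Suc numeral_2_eq_2)

lemma det_3_3:
  fixes B :: "'a :: comm_ring_1 mat"
  assumes "B \<in> carrier_mat 3 3"
  shows "Determinant.det B =
      B $$ (0, 0) * (B $$ (1, 1) * B $$ (2, 2) - B $$ (1, 2) * B $$ (2, 1))
    - B $$ (0, 1) * (B $$ (1, 0) * B $$ (2, 2) - B $$ (1, 2) * B $$ (2, 0))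
    + B $$ (0, 2) * (B $$ (1, 0) * B $$ (2, 1) - B $$ (1, 1) * B $$ (2, 0))"
  using assms
  by (subst laplace_expansion_row[OF assms, of 0])
    (simp_all add: cofactor_def det_2_2[unfolded numeral_2_eq_2] mat_delete_def lessThan_Suc
      numeral_2_eq_2 numeral_3_eq_3 algebra_simps)

lemma det_4_4:
  fixes A :: "'a :: comm_ring_1 mat"
  assumes "A \<in> carrier_mat 4 4"
  defines "m \<equiv> \<lambda>i j. A $$ (i, j)"
  shows "Determinant.det A =
      m 0 0 * (m 1 1 * (m 2 2 * m 3 3 - m 2 3 * m 3 2) - m 1 2 * (m 2 1 * m 3 3 - m 2 3 * m 3 1)
        + m 1 3 * (m 2 1 * m 3 2 - m 2 2 * m 3 1))
    - m 0 1 * (m 1 0 * (m 2 2 * m 3 3 - m 2 3 * m 3 2) - m 1 2 * (m 2 0 * m 3 3 - m 2 3 * m 3 0)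
        + m 1 3 * (m 2 0 * m 3 2 - m 2 2 * m 3 0))
    + m 0 2 * (m 1 0 * (m 2 1 * m 3 3 - m 2 3 * m 3 1) - m 1 1 * (m 2 0 * m 3 3 - m 2 3 * m 3 0)
        + m 1 3 * (m 2 0 * m 3 1 - m 2 1 * m 3 0))
    - m 0 3 * (m 1 0 * (m 2 1 * m 3 2 - m 2 2 * m 3 1) - m 1 1 * (m 2 0 * m 3 2 - m 2 2 * m 3 0)
        + m 1 2 * (m 2 0 * m 3 1 - m 2 1 * m 3 0))"
  using assms(1) unfolding m_def
  by (subst laplace_expansion_row[OF assms(1), of 0])
    (simp_all add: cofactor_def det_3_3[unfolded numeral_2_eq_2 numeral_3_eq_3] mat_delete_def
      lessThan_Suc numeral_2_eq_2 numeral_3_eq_3 eval_nat_numeral algebra_simps)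

lemma coeff_prod_3_linear:
  fixes a b c a' b' c' :: "'a :: comm_ring_1"
  defines "p \<equiv> [:a, a':] * [:b, b':] * [:c, c':]"
  shows "coeff p 0 = a * b * c" "coeff p 1 = a' * b * c + a * b' * c + a * b * c'"
    "coeff p 2 = a' * b' * c + a' * b * c' + a * b' * c'" "coeff p 3 = a' * b' * c'"
  by (simp_all add: p_def algebra_simps numeral_eq_Suc)

text \<open>Every product in the expansion uses each row once, hence one coefficient of each of the
  twelve linear factors; these pair up by edges. The identity holds for 24 free coefficients, before
  unit length or roots enter.\<close>

lemma det_coeff_products:
  fixes c :: "nat \<Rightarrow> nat \<Rightarrow> nat \<Rightarrow> complex"
  shows "Determinant.det
      (mat 4 4 (\<lambda>(i, n). coeff (\<Prod>j\<in>{1..4} - {i + 1}. [:c (i + 1) j 0, c (i + 1) j 1:]) n)) =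
    edge_form (\<lambda>p q. c 1 2 p * c 2 1 q) (\<lambda>p q. c 1 3 p * c 3 1 q) (\<lambda>p q. c 2 3 p * c 3 2 q)
      (\<lambda>p q. c 1 4 p * c 4 1 q) (\<lambda>p q. c 2 4 p * c 4 2 q) (\<lambda>p q. c 3 4 p * c 4 3 q)"
proof -
  let ?l = "\<lambda>i j. [:c i j 0, c i j 1:]"
  let ?A = "mat 4 4 (\<lambda>(i, n). coeff (\<Prod>j\<in>{1..4} - {i + 1}. ?l (i + 1) j) n)"
  have sets: "{1..4} - {1} = {2, 3, 4 :: nat}" "{1..4} - {2} = {1, 3, 4 :: nat}"
    "{1..4} - {3} = {1, 2, 4 :: nat}" "{1..4} - {4} = {1, 2, 3 :: nat}"
    by auto
  have rows: "(\<Prod>j\<in>{1..4} - {1}. ?l 1 j) = ?l 1 2 * ?l 1 3 * ?l 1 4"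
    "(\<Prod>j\<in>{1..4} - {2}. ?l 2 j) = ?l 2 1 * ?l 2 3 * ?l 2 4"
    "(\<Prod>j\<in>{1..4} - {3}. ?l 3 j) = ?l 3 1 * ?l 3 2 * ?l 3 4"
    "(\<Prod>j\<in>{1..4} - {4}. ?l 4 j) = ?l 4 1 * ?l 4 2 * ?l 4 3"
    unfolding sets by (simp_all del: mult_pCons_left mult_pCons_right One_nat_def)
  have entries: "?A $$ (0, n) = coeff (?l 1 2 * ?l 1 3 * ?l 1 4) n"
    "?A $$ (1, n) = coeff (?l 2 1 * ?l 2 3 * ?l 2 4) n"
    "?A $$ (2, n) = coeff (?l 3 1 * ?l 3 2 * ?l 3 4) n"
    "?A $$ (3, n) = coeff (?l 4 1 * ?l 4 2 * ?l 4 3) n" if "n < 4" for n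
    unfolding rows[symmetric] using that
    by (simp_all del: mult_pCons_left mult_pCons_right One_nat_def)
  have lt: "(0::nat) < 4" "(1::nat) < 4" "(2::nat) < 4" "(3::nat) < 4"
    by simp_all
  have "?A \<in> carrier_mat 4 4"
    by simp
  \<comment> \<open>Qualified, since HOL-Algebra has a different method of the same name.\<close>
  then show ?thesis
    unfolding det_4_4[OF \<open>?A \<in> carrier_mat 4 4\<close>]
      entries[OF lt(1)] entries[OF lt(2)] entries[OF lt(3)] entries[OF lt(4)]
      coeff_prod_3_linear edge_form_def
    by Groebner_Basis.algebra
qed

section \<open>The polynomial identity behind the Eastwood-Norbury formula\<close>

text \<open>For an edge vector (x, y, z) of length \<open>r\<close>, the intended values are
  \<open>w\<close> = x + iy and \<open>v\<close> = x - iy. Keeping \<open>v\<close> as a separate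
  variable makes the later identities polynomial, free of conjugation.\<close>

definition edge_tensor :: "'a :: comm_ring_1 \<Rightarrow> 'a \<Rightarrow> 'a \<Rightarrow> 'a \<Rightarrow> 'a edge_coeffs" where
  "edge_tensor r z w v p q = (if p = 0 then if q = 0 then - w else - (r + z)
    else if q = 0 then r - z else v)"

lemma edge_tensor_simps:
  "edge_tensor r z w v 0 0 = - w" "edge_tensor r z w v 0 1 = - (r + z)"
  "edge_tensor r z w v 1 0 = r - z" "edge_tensor r z w v 1 1 = v"
  by (simp_all add: edge_tensor_def)

text \<open>The contribution of the vertex \<open>l\<close> to \<open>A\<^sub>4\<close>: the edges \<open>p, q, t\<close> issue from \<open>l\<close> and
  \<open>a, b, c\<close> are the edges of the opposite face, in the order in which they are skew to
  \<open>p, q, t\<close>.\<close>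

definition face_term :: "real \<Rightarrow> real \<Rightarrow> real \<Rightarrow> real \<Rightarrow> real \<Rightarrow> real \<Rightarrow> real" where
  "face_term p q t a b c =
    (p * ((q + t)\<^sup>2 - a\<^sup>2) + q * ((p + t)\<^sup>2 - b\<^sup>2) + t * ((p + q)\<^sup>2 - c\<^sup>2)) * d3 a b c"

text \<open>In the following two definitions capital letters stand for the squares of the corresponding
  edge lengths. This makes everything linear in each edge length, so that the identity
  \<open>edge_form_geometric\<close> holds without any relation between edge lengths and coordinates other
  than the substitution of the squares.\<close>

definition d3_lin :: "'a \<Rightarrow> 'a \<Rightarrow> 'a \<Rightarrow> 'a \<Rightarrow> 'a \<Rightarrow> 'a \<Rightarrow> 'a :: comm_ring_1" where
  "d3_lin a b c A B C = A * (b + c - a) + B * (a + c - b) + C * (a + b - c) - 2 * a * b * c"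

definition face_lin :: "'a \<Rightarrow> 'a \<Rightarrow> 'a \<Rightarrow> 'a \<Rightarrow> 'a \<Rightarrow> 'a \<Rightarrow>
    'a \<Rightarrow> 'a \<Rightarrow> 'a \<Rightarrow> 'a \<Rightarrow> 'a \<Rightarrow> 'a \<Rightarrow> 'a :: comm_ring_1" where
  "face_lin p q t a b c P Q T A B C =
    (p * (Q + T + 2 * q * t - A) + q * (P + T + 2 * p * t - B) + t * (P + Q + 2 * p * q - C))
      * d3_lin a b c A B C"

lemma of_real_d3:
  "(of_real (d3 a b c) :: complex) = d3_lin (of_real a) (of_real b) (of_real c)
    (of_real (a\<^sup>2)) (of_real (b\<^sup>2)) (of_real (c\<^sup>2))"
  unfolding d3_def d3_lin_def of_real_add of_real_diff of_real_mult of_real_power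
  by Groebner_Basis.algebra

lemma of_real_face_term:
  "(of_real (face_term p q t a b c) :: complex) =
    face_lin (of_real p) (of_real q) (of_real t) (of_real a) (of_real b) (of_real c)
      (of_real (p\<^sup>2)) (of_real (q\<^sup>2)) (of_real (t\<^sup>2)) (of_real (a\<^sup>2)) (of_real (b\<^sup>2)) (of_real (c\<^sup>2))"
  unfolding face_term_def face_lin_def of_real_mult of_real_d3
  by (simp add: power2_eq_square algebra_simps)

text \<open>The fourth point is the origin. The second form has \<open>w\<close> and
  \<open>v\<close> swapped, so for actual points it is the conjugate of the first. The last square
  is that of the determinant with rows (w_i, v_i, z_i) and becomes the volume term.\<close>

lemma edge_form_geometric:
  fixes r12 r13 r23 r14 r24 r34 w1 w2 w3 v1 v2 v3 z1 z2 z3 :: complex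
  assumes sq: "s12 = (w2 - w1) * (v2 - v1) + (z2 - z1)\<^sup>2"
    "s13 = (w3 - w1) * (v3 - v1) + (z3 - z1)\<^sup>2"
    "s23 = (w3 - w2) * (v3 - v2) + (z3 - z2)\<^sup>2"
    "s14 = w1 * v1 + z1\<^sup>2" "s24 = w2 * v2 + z2\<^sup>2" "s34 = w3 * v3 + z3\<^sup>2"
  shows
    "edge_form (edge_tensor r12 (z2 - z1) (w2 - w1) (v2 - v1))
        (edge_tensor r13 (z3 - z1) (w3 - w1) (v3 - v1))
        (edge_tensor r23 (z3 - z2) (w3 - w2) (v3 - v2))
        (edge_tensor r14 (- z1) (- w1) (- v1)) (edge_tensor r24 (- z2) (- w2) (- v2))
        (edge_tensor r34 (- z3) (- w3) (- v3))
     + edge_form (edge_tensor r12 (z2 - z1) (v2 - v1) (w2 - w1))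
        (edge_tensor r13 (z3 - z1) (v3 - v1) (w3 - w1))
        (edge_tensor r23 (z3 - z2) (v3 - v2) (w3 - w2))
        (edge_tensor r14 (- z1) (- v1) (- w1)) (edge_tensor r24 (- z2) (- v2) (- w2))
        (edge_tensor r34 (- z3) (- v3) (- w3)) =
     2 * (64 * (r12 * r13 * r14 * r23 * r24 * r34)
      - 4 * d3_lin (r12 * r34) (r13 * r24) (r14 * r23) (s12 * s34) (s13 * s24) (s14 * s23)
      + face_lin r12 r13 r14 r34 r24 r23 s12 s13 s14 s34 s24 s23
      + face_lin r12 r23 r24 r34 r14 r13 s12 s23 s24 s34 s14 s13
      + face_lin r13 r23 r34 r24 r14 r12 s13 s23 s34 s24 s14 s12
      + face_lin r14 r24 r34 r23 r13 r12 s14 s24 s34 s23 s13 s12)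
     - 4 * (w1 * (v2 * z3 - v3 * z2) - w2 * (v1 * z3 - v3 * z1) + w3 * (v1 * z2 - v2 * z1))\<^sup>2"
  unfolding edge_form_def edge_tensor_simps d3_lin_def face_lin_def sq by Groebner_Basis.algebra

section \<open>From unit lifts to Hermitian matrices\<close>

text \<open>The root is w / (r - z), and |w|^2 = (r - z) (r + z). Together with the unit length of
  (\<alpha>, \<beta>) this determines all products of a coefficient with a conjugate coefficient,
  whatever the phase.\<close>

lemma spinor_edge_tensor:
  fixes u :: "real ^ 3"
  assumes u: "u \<noteq> 0" and unit: "(cmod \<alpha>)\<^sup>2 + (cmod \<beta>)\<^sup>2 = 1"
    and root: "linear_root \<alpha> \<beta> (stereographic (u /\<^sub>R norm u))"
  defines "r \<equiv> norm u" and "z \<equiv> vec_nth u 3" and "w \<equiv> Complex (vec_nth u 1) (vec_nth u 2)"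
  shows "2 * of_real r * (\<beta> * cnj \<alpha>) = - w"
    "2 * of_real r * (\<beta> * - cnj \<beta>) = - (of_real r + of_real z)"
    "2 * of_real r * (\<alpha> * cnj \<alpha>) = of_real r - of_real z" "2 * of_real r * (\<alpha> * - cnj \<beta>) = cnj w"
proof -
  have r: "r > 0"
    using u by (simp add: r_def)
  have norm: "w * cnj w + (of_real z)\<^sup>2 = (of_real r)\<^sup>2"
    by (simp add: w_def z_def r_def norm_vec_def L2_set_def sum_3 complex_mult_cnj
        flip: of_real_power of_real_add)
  have ab: "\<alpha> * cnj \<alpha> + \<beta> * cnj \<beta> = 1"
    using unit by (metis complex_norm_square of_real_1 of_real_add)
  \<comment> \<open>The root condition with denominators cleared. At the north pole, r = z and w =
    0, so the equation is empty there and \<alpha> = 0 has to be recorded separately.\<close>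
  have rt: "\<alpha> * w = - \<beta> * (of_real r - of_real z) \<and> (r = z \<longrightarrow> \<alpha> = 0)"
  proof (cases "r = z")
    case True
    then have "vec_nth (u /\<^sub>R norm u) 3 = 1"
      using r by (simp add: r_def z_def)
    then show ?thesis using root True
      by (simp add: stereographic_def linear_root_def)
  next
    case False
    then have "vec_nth (u /\<^sub>R norm u) 3 \<noteq> 1"
      using r by (simp add: r_def z_def field_simps)
    then have "\<alpha> * (Complex (vec_nth u 1 / r) (vec_nth u 2 / r) / of_real (1 - z / r)) + \<beta> = 0"
      using root by (simp add: stereographic_def linear_root_def r_def z_def divide_inverse_commute)
    moreover have "Complex (vec_nth u 1 / r) (vec_nth u 2 / r) = w / of_real r"
      by (simp add: w_def complex_eq_iff)
    moreover have "complex_of_real (1 - z / r) = (of_real r - of_real z) / of_real r"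
      using r by (simp add: field_simps)
    ultimately have "\<alpha> * (w / (of_real r - of_real z)) + \<beta> = 0"
      using r by simp
    moreover have "complex_of_real r - of_real z \<noteq> 0"
      using False by simp
    ultimately show ?thesis
      using False by (simp add: field_simps)
  qed
  have A: "2 * of_real r * (\<alpha> * cnj \<alpha>) = of_real r - of_real z"
  proof (cases "r = z")
    case False
    have "cnj (\<alpha> * w) = - cnj \<beta> * (of_real r - of_real z)"
      using rt by simp
    \<comment> \<open>Multiply the root equation by its conjugate, then eliminate |\<beta>|^2 and
      |w|^2.\<close>
    then have "(of_real r - of_real z) * (2 * of_real r * (\<alpha> * cnj \<alpha>)) =
        (of_real r - of_real z) * (of_real r - of_real z)"
      using conjunct1[OF rt] norm ab unfolding complex_cnj_mult by Groebner_Basis.algebra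
    with False show ?thesis
      by (metis eq_iff_diff_eq_0 mult_left_cancel of_real_eq_iff)
  qed (use rt in simp)
  show "2 * of_real r * (\<alpha> * cnj \<alpha>) = of_real r - of_real z"
    by (rule A)
  then show "2 * of_real r * (\<beta> * - cnj \<beta>) = - (of_real r + of_real z)"
    using ab by Groebner_Basis.algebra
  show C: "2 * of_real r * (\<beta> * cnj \<alpha>) = - w"
  proof (cases "r = z")
    case True
    then show ?thesis using rt norm by simp
  next
    case False
    have "(of_real r - of_real z) * (2 * of_real r * (\<beta> * cnj \<alpha>)) = (of_real r - of_real z) * (- w)"
      using conjunct1[OF rt] A by Groebner_Basis.algebra
    with False show ?thesis
      by (metis eq_iff_diff_eq_0 mult_left_cancel of_real_eq_iff)
  qed
  from arg_cong[OF C, of "\<lambda>t. - cnj t"] show "2 * of_real r * (\<alpha> * - cnj \<beta>) = cnj w"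
    by (simp add: mult_ac)
qed

section \<open>Volume and Gram determinant\<close>

definition triple_product :: "real ^ 3 \<Rightarrow> real ^ 3 \<Rightarrow> real ^ 3 \<Rightarrow> real" where
  "triple_product u v w =
    vec_nth u 1 * (vec_nth v 2 * vec_nth w 3 - vec_nth w 2 * vec_nth v 3)
    - vec_nth v 1 * (vec_nth u 2 * vec_nth w 3 - vec_nth w 2 * vec_nth u 3)
    + vec_nth w 1 * (vec_nth u 2 * vec_nth v 3 - vec_nth v 2 * vec_nth u 3)"

lemma norm_sq_3: "(norm (u :: real ^ 3))\<^sup>2 = (vec_nth u 1)\<^sup>2 + (vec_nth u 2)\<^sup>2 + (vec_nth u 3)\<^sup>2"
  by (simp add: norm_vec_def L2_set_def sum_3)

text \<open>The squared determinant is the Gram determinant. Since \<open>g u v\<close> is twice the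
  inner product, the factor 8 clears denominators, and only edge lengths remain on the
  right.\<close>

lemma triple_product_gram:
  defines "g \<equiv> \<lambda>u v :: real ^ 3. (norm u)\<^sup>2 + (norm v)\<^sup>2 - (norm (u - v))\<^sup>2"
  shows "8 * (triple_product u v w)\<^sup>2 =
    8 * (norm u)\<^sup>2 * (norm v)\<^sup>2 * (norm w)\<^sup>2 + 2 * g u v * g u w * g v w
    - 2 * (norm u)\<^sup>2 * (g v w)\<^sup>2 - 2 * (norm v)\<^sup>2 * (g u w)\<^sup>2 - 2 * (norm w)\<^sup>2 * (g u v)\<^sup>2"
  unfolding g_def triple_product_def norm_sq_3 vector_minus_component by Groebner_Basis.algebra

lemma tetrahedron_volume_eq:
  assumes "inj_on x {1..4}"
  shows "tetrahedron_volume x = \<bar>triple_product (x 1 - x 4) (x 2 - x 4) (x 3 - x 4)\<bar> / 6"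
proof -
  \<comment> \<open>\<open>content_simplex\<close> takes one vertex as base point, here
    \<open>x 4\<close>, and the others enumerated by the index type 3.\<close>
  define f :: "3 \<Rightarrow> real ^ 3" where "f j = (if j = 1 then x 1 else if j = 2 then x 2 else x 3)" for j
  have f: "f 1 = x 1" "f 2 = x 2" "f 3 = x 3"
    by (simp_all add: f_def)
  have four: "{1..4} = {1, 2, 3, 4 :: nat}"
    by auto
  have ne: "x 1 \<noteq> x 2" "x 1 \<noteq> x 3" "x 2 \<noteq> x 3" "x 1 \<noteq> x 4" "x 2 \<noteq> x 4" "x 3 \<noteq> x 4"
    using assms unfolding four by (auto simp: inj_on_def)
  have "card (x ` {1..4}) = Suc CARD(3)"
    using card_image[OF assms] by simp
  moreover have "bij_betw f UNIV (x ` {1..4} - {x 4})"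
    unfolding bij_betw_def four UNIV_3 inj_on_def using ne f by auto
  ultimately have "measure lborel (convex hull (x ` {1..4})) =
      \<bar>Determinants.det (\<chi> i j. vec_nth (f j) i - vec_nth (x 4) i)\<bar> / fact CARD(3)"
    by (intro content_simplex) auto
  also have "Determinants.det (\<chi> i j. vec_nth (f j) i - vec_nth (x 4) i) =
      triple_product (x 1 - x 4) (x 2 - x 4) (x 3 - x 4)"
    by (simp add: det_3 f triple_product_def) Groebner_Basis.algebra
  finally show ?thesis
    by (simp add: tetrahedron_volume_def fact_numeral)
qed

lemma edge_product_eq:
  "edge_product x = dist (x 1) (x 2) * dist (x 1) (x 3) * dist (x 1) (x 4) *
    dist (x 2) (x 3) * dist (x 2) (x 4) * dist (x 3) (x 4)"
proof -
  have "{1..4} = {1, 2, 3, 4 :: nat}" "{1..<2} = {1 :: nat}" "{1..<3} = {1, 2 :: nat}"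
    "{1..<4} = {1, 2, 3 :: nat}"
    by auto
  then show ?thesis
    by (simp add: edge_product_def)
qed

section \<open>The Eastwood-Norbury formula\<close>

text \<open>Adding D_4 to its conjugate reduces this to \<open>edge_form_geometric\<close>. The four
  \<open>face_term\<close> summands are those of A_4 for l = 1, 2, 3, 4.\<close>

theorem eastwood_norbury:
  fixes x :: "nat \<Rightarrow> real ^ 3"
  assumes inj: "inj_on x {1..4}" and lift: "admissible_lift x \<alpha> \<beta>"
  defines "r \<equiv> \<lambda>i j. dist (x i) (x j)"
  shows "Re (atiyah_D4 x \<alpha> \<beta>) = 64 * edge_product x
    - 4 * d3 (r 1 2 * r 3 4) (r 1 3 * r 2 4) (r 1 4 * r 2 3)
    + face_term (r 1 2) (r 1 3) (r 1 4) (r 3 4) (r 2 4) (r 2 3)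
    + face_term (r 1 2) (r 2 3) (r 2 4) (r 3 4) (r 1 4) (r 1 3)
    + face_term (r 1 3) (r 2 3) (r 3 4) (r 2 4) (r 1 4) (r 1 2)
    + face_term (r 1 4) (r 2 4) (r 3 4) (r 2 3) (r 1 3) (r 1 2)
    + 288 * (tetrahedron_volume x)\<^sup>2"
proof -
  \<comment> \<open>The coefficient of t^p in l_ij, for p = 0 or 1.\<close>
  define c where "c i j p = (if i < j then if p = 0 then \<beta> i j else \<alpha> i j
    else if p = 0 then cnj (\<alpha> j i) else - cnj (\<beta> j i))" for i j p :: nat
  \<comment> \<open>Coordinates are taken relative to \<open>x 4\<close>, which becomes the origin
    of \<open>edge_form_geometric\<close>.\<close>
  define w where "w i = Complex (vec_nth (x i - x 4) 1) (vec_nth (x i - x 4) 2)" for i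
  define z where "z i = vec_nth (x i - x 4) 3" for i
  define R where "R i j = complex_of_real (r i j)" for i j
  define Z where "Z i = complex_of_real (z i)" for i
  define e where "e i j =
       edge_tensor (R i j) (Z j - Z i) (w j - w i) (cnj (w j) - cnj (w i))" for i j
  define e' where "e' i j =
       edge_tensor (R i j) (Z j - Z i) (cnj (w j) - cnj (w i)) (w j - w i)" for i j
  have origin: "w 4 = 0" "Z 4 = 0"
    by (simp_all add: w_def z_def Z_def complex_eq_iff)
  have edge: "2 * R i j * (c i j p * c j i q) = e i j p q"
    if "i \<in> {1..4}" "j \<in> {1..4}" "i < j" "p \<le> 1" "q \<le> 1" for i j p q
  proof -
    have "x j - x i \<noteq> 0"
      using inj that by (auto dest: inj_onD)
    moreover have "(cmod (\<alpha> i j))\<^sup>2 + (cmod (\<beta> i j))\<^sup>2 = 1"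
      "linear_root (\<alpha> i j) (\<beta> i j) (stereographic ((x j - x i) /\<^sub>R norm (x j - x i)))"
      using lift that unfolding admissible_lift_def direction_point_def
      by (auto simp: dist_norm norm_minus_commute)
    moreover have "Complex (vec_nth (x j - x i) 1) (vec_nth (x j - x i) 2) = w j - w i"
      "complex_of_real (vec_nth (x j - x i) 3) = Z j - Z i"
      "complex_of_real (norm (x j - x i)) = R i j"
      by (simp_all add: w_def z_def Z_def R_def r_def complex_eq_iff dist_norm norm_minus_commute)
    ultimately have "2 * R i j * (\<beta> i j * cnj (\<alpha> i j)) = e i j 0 0"
      "2 * R i j * (\<beta> i j * - cnj (\<beta> i j)) = e i j 0 1"
      "2 * R i j * (\<alpha> i j * cnj (\<alpha> i j)) = e i j 1 0"
      "2 * R i j * (\<alpha> i j * - cnj (\<beta> i j)) = e i j 1 1"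
      using spinor_edge_tensor[of "x j - x i" "\<alpha> i j" "\<beta> i j"]
      unfolding e_def edge_tensor_simps complex_cnj_diff[symmetric] by simp_all
    moreover have "p = 0 \<or> p = 1" "q = 0 \<or> q = 1"
      using that by auto
    ultimately show ?thesis
      using that(3) by (auto simp: c_def)
  qed
  have "atiyah_poly \<alpha> \<beta> i = (\<Prod>j\<in>{1..4} - {i}. [:c i j 0, c i j 1:])" for i
    unfolding atiyah_poly_def by (intro prod.cong refl) (simp add: atiyah_linear_def c_def)
  then have "atiyah_D4 x \<alpha> \<beta> = 64 * complex_of_real (edge_product x) *
    edge_form (\<lambda>p q. c 1 2 p * c 2 1 q) (\<lambda>p q. c 1 3 p * c 3 1 q) (\<lambda>p q. c 2 3 p * c 3 2 q)
      (\<lambda>p q. c 1 4 p * c 4 1 q) (\<lambda>p q. c 2 4 p * c 4 2 q) (\<lambda>p q. c 3 4 p * c 4 3 q)"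
    unfolding atiyah_D4_def atiyah_matrix_def by (simp only: det_coeff_products)
  also have "64 * complex_of_real (edge_product x) =
      (2 * R 1 2) * (2 * R 1 3) * (2 * R 2 3) * (2 * R 1 4) * (2 * R 2 4) * (2 * R 3 4)"
    by (simp add: edge_product_eq R_def r_def)
  also have "\<dots> * edge_form (\<lambda>p q. c 1 2 p * c 2 1 q) (\<lambda>p q. c 1 3 p * c 3 1 q)
      (\<lambda>p q. c 2 3 p * c 3 2 q) (\<lambda>p q. c 1 4 p * c 4 1 q) (\<lambda>p q. c 2 4 p * c 4 2 q)
      (\<lambda>p q. c 3 4 p * c 4 3 q) =
      edge_form (e 1 2) (e 1 3) (e 2 3) (e 1 4) (e 2 4) (e 3 4)"
    unfolding edge_form_scale[symmetric] by (intro edge_form_cong edge) auto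
  finally have D: "atiyah_D4 x \<alpha> \<beta> = edge_form (e 1 2) (e 1 3) (e 2 3) (e 1 4) (e 2 4) (e 3 4)" .
  have "(\<lambda>p q. cnj (e i j p q)) = e' i j" for i j
    unfolding e_def e'_def edge_tensor_def R_def Z_def by (auto simp: fun_eq_iff)
  then have D': "cnj (atiyah_D4 x \<alpha> \<beta>) =
      edge_form (e' 1 2) (e' 1 3) (e' 2 3) (e' 1 4) (e' 2 4) (e' 3 4)"
    unfolding D cnj_edge_form by simp
  have sq: "(complex_of_real (r i j))\<^sup>2 =
      (w j - w i) * (cnj (w j) - cnj (w i)) + (Z j - Z i)\<^sup>2" for i j
  proof -
    have "(w j - w i) * (cnj (w j) - cnj (w i)) =
        complex_of_real ((vec_nth (x i - x j) 1)\<^sup>2 + (vec_nth (x i - x j) 2)\<^sup>2)"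
      by (simp add: w_def complex_eq_iff power2_eq_square algebra_simps)
    moreover have "(Z j - Z i)\<^sup>2 = complex_of_real ((vec_nth (x i - x j) 3)\<^sup>2)"
      by (simp add: Z_def z_def power2_commute)
    ultimately show ?thesis
      unfolding r_def dist_norm by (simp add: norm_sq_3 flip: of_real_power)
  qed
  let ?t = "triple_product (x 1 - x 4) (x 2 - x 4) (x 3 - x 4)"
  \<comment> \<open>Passing from (x, y, z) to (x + iy, x - iy, z) multiplies the determinant by -2i.
    So the term -4 (...)^2 becomes 16 \<open>?t\<close>^2, twice 288 V^2.\<close>
  have det: "w 1 * (cnj (w 2) * Z 3 - cnj (w 3) * Z 2) - w 2 * (cnj (w 1) * Z 3 - cnj (w 3) * Z 1)
      + w 3 * (cnj (w 1) * Z 2 - cnj (w 2) * Z 1) = - 2 * \<i> * complex_of_real ?t"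
    by (simp add: w_def Z_def z_def triple_product_def complex_eq_iff algebra_simps)
  have "complex_of_real (2 * Re (atiyah_D4 x \<alpha> \<beta>)) =
      edge_form (e 1 2) (e 1 3) (e 2 3) (e 1 4) (e 2 4) (e 3 4)
      + edge_form (e' 1 2) (e' 1 3) (e' 2 3) (e' 1 4) (e' 2 4) (e' 3 4)"
    unfolding D[symmetric] D'[symmetric] by (simp add: complex_add_cnj)
  also have "\<dots> = 2 * (64 * (R 1 2 * R 1 3 * R 1 4 * R 2 3 * R 2 4 * R 3 4)
    - 4 * of_real (d3 (r 1 2 * r 3 4) (r 1 3 * r 2 4) (r 1 4 * r 2 3))
    + of_real (face_term (r 1 2) (r 1 3) (r 1 4) (r 3 4) (r 2 4) (r 2 3))
    + of_real (face_term (r 1 2) (r 2 3) (r 2 4) (r 3 4) (r 1 4) (r 1 3))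
    + of_real (face_term (r 1 3) (r 2 3) (r 3 4) (r 2 4) (r 1 4) (r 1 2))
    + of_real (face_term (r 1 4) (r 2 4) (r 3 4) (r 2 3) (r 1 3) (r 1 2)))
    - 4 * (- 2 * \<i> * of_real ?t)\<^sup>2"
    unfolding e_def e'_def origin complex_cnj_zero diff_0 det[symmetric] of_real_face_term of_real_d3
      power_mult_distrib of_real_mult R_def[symmetric]
    by (rule edge_form_geometric) (simp_all add: sq origin)
  also have "\<dots> = complex_of_real (2 * (64 * edge_product x
    - 4 * d3 (r 1 2 * r 3 4) (r 1 3 * r 2 4) (r 1 4 * r 2 3)
    + face_term (r 1 2) (r 1 3) (r 1 4) (r 3 4) (r 2 4) (r 2 3)
    + face_term (r 1 2) (r 2 3) (r 2 4) (r 3 4) (r 1 4) (r 1 3)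
    + face_term (r 1 3) (r 2 3) (r 3 4) (r 2 4) (r 1 4) (r 1 2)
    + face_term (r 1 4) (r 2 4) (r 3 4) (r 2 3) (r 1 3) (r 1 2) + 8 * ?t\<^sup>2))"
    by (simp add: edge_product_eq R_def r_def power_mult_distrib)
  finally have "2 * Re (atiyah_D4 x \<alpha> \<beta>) = 2 * (64 * edge_product x
    - 4 * d3 (r 1 2 * r 3 4) (r 1 3 * r 2 4) (r 1 4 * r 2 3)
    + face_term (r 1 2) (r 1 3) (r 1 4) (r 3 4) (r 2 4) (r 2 3)
    + face_term (r 1 2) (r 2 3) (r 2 4) (r 3 4) (r 1 4) (r 1 3)
    + face_term (r 1 3) (r 2 3) (r 3 4) (r 2 4) (r 1 4) (r 1 2)
    + face_term (r 1 4) (r 2 4) (r 3 4) (r 2 3) (r 1 3) (r 1 2) + 8 * ?t\<^sup>2)"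
    by (simp only: of_real_eq_iff)
  moreover have "288 * (tetrahedron_volume x)\<^sup>2 = 8 * ?t\<^sup>2"
    by (simp add: tetrahedron_volume_eq[OF inj] power_divide)
  ultimately show ?thesis
    by simp
qed

section \<open>The inequality for upright tetrahedra\<close>

text \<open>Difference of the two sides of the theorem for \<open>a = r\<^sub>2\<^sub>3\<close>, \<open>b = r\<^sub>1\<^sub>3\<close>, \<open>c = r\<^sub>1\<^sub>2\<close> and
  \<open>r = r\<^sub>1\<^sub>4 = r\<^sub>2\<^sub>4 = r\<^sub>3\<^sub>4\<close>; the summand with the factor 3 is \<open>3 * 288 V\<^sup>2\<close>.\<close>

definition upright_gap :: "real \<Rightarrow> real \<Rightarrow> real \<Rightarrow> real \<Rightarrow> real" where
  "upright_gap a b c r =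
    - 4 * d3 (c * r) (b * r) (r * a)
    + face_term c b r r r a + face_term c a r r r b + face_term b a r r r c + face_term r r r a b c
    - 3 * (8 * r\<^sup>2 * r\<^sup>2 * r\<^sup>2 + 2 * (2 * r\<^sup>2 - c\<^sup>2) * (2 * r\<^sup>2 - b\<^sup>2) * (2 * r\<^sup>2 - a\<^sup>2)
      - 2 * r\<^sup>2 * ((2 * r\<^sup>2 - a\<^sup>2)\<^sup>2 + (2 * r\<^sup>2 - b\<^sup>2)\<^sup>2 + (2 * r\<^sup>2 - c\<^sup>2)\<^sup>2))
    - (4 + 1 / 4) * (c * b * r * d3 a r r + c * a * r * d3 b r r + b * a * r * d3 c r r
      + r * r * r * d3 c b a)"

text \<open>Relabelling the base vertices changes nothing. These two transpositions generate all
  permutations of the sides, so the sides may be ordered.\<close>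

lemma upright_gap_commute:
  "upright_gap a b c r = upright_gap b a c r"
  "upright_gap a b c r = upright_gap a c b r"
  unfolding upright_gap_def face_term_def d3_def by Groebner_Basis.algebra+

text \<open>Here \<open>z \<ge> 0\<close> encodes the triangle inequality, \<open>v, w \<ge> 0\<close> the ordering \<open>b \<le> a \<le> c\<close> and
  \<open>u \<ge> 0\<close> the inequality \<open>c \<le> 2 * r\<close>.\<close>

lemma upright_gap_ravi:
  "4 * upright_gap (2 * z + v + 2 * w) (2 * z + v) (2 * z + 2 * v + 2 * w) (z + v + w + u) =
    4 * (30 * z^6 + 180 * w^4 * z^2 + 506 * w^3 * z^3 + 438 * w^2 * z^4 + 142 * w * z^5 + 51 * v^6
        + 242 * v^5 * z + 306 * v^5 * w + 461 * v^4 * z^2 + 663 * v^4 * w^2 + 1210 * v^4 * w * z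
        + 478 * v^3 * z^3 + 612 * v^3 * w^3 + 2056 * v^3 * w^2 * z + 1844 * v^3 * w * z^2
        + 320 * v^2 * z^4 + 204 * v^2 * w^4 + 1328 * v^2 * w^3 * z + 2414 * v^2 * w^2 * z^2
        + 1434 * v^2 * w * z^3 + 142 * v * z^5 + 240 * v * w^4 * z + 1140 * v * w^3 * z^2
        + 1462 * v * w^2 * z^3 + 640 * v * w * z^4)
    + 4 * u * (66 * z^5 + 240 * w^4 * z + 804 * w^3 * z^2 + 826 * w^2 * z^3 + 264 * w * z^4
        + 83 * v^5 + 357 * v^4 * z + 415 * v^4 * w + 598 * v^3 * z^2 + 724 * v^3 * w^2
        + 1428 * v^3 * w * z + 522 * v^2 * z^3 + 512 * v^2 * w^3 + 1978 * v^2 * w^2 * z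
        + 1794 * v^2 * w * z^2 + 264 * v * z^4 + 120 * v * w^4 + 1100 * v * w^3 * z
        + 2000 * v * w^2 * z^2 + 1044 * v * w * z^3)
    + 8 * u^2 * (33 * z^4 + 56 * w^3 * z + 158 * w^2 * z^2 + 103 * w * z^3 + 14 * v^4
        + 72 * v^3 * z + 56 * v^3 * w + 128 * v^2 * z^2 + 70 * v^2 * w^2 + 216 * v^2 * w * z
        + 103 * v * z^3 + 28 * v * w^3 + 200 * v * w^2 * z + 256 * v * w * z^2)
    + 120 * u^3 * (z^3 + 2 * w * z^2 + v^2 * z + 2 * v * z^2 + 2 * v * w * z)"
  unfolding upright_gap_def face_term_def d3_def by Groebner_Basis.algebra

lemma upright_gap_nonneg:
  assumes "a \<le> b + c" "b \<le> a + c" "c \<le> a + b" "a \<le> 2 * r" "b \<le> 2 * r" "c \<le> 2 * r"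
  shows "0 \<le> upright_gap a b c r"
proof -
  \<comment> \<open>With \<open>c\<close> the longest side, c \<le> a + b and c \<le> 2 r imply the
    other bounds.\<close>
  have *: "0 \<le> upright_gap a b c r" if "b \<le> a" "a \<le> c" "c \<le> a + b" "c \<le> 2 * r" for a b c
  proof -
    \<comment> \<open>The inverse of the substitution in \<open>upright_gap_ravi\<close>; all
      coefficients there are nonnegative.\<close>
    define z v w u where "z = (a + b - c) / 2" and "v = c - a" and "w = (a - b) / 2"
      and "u = r - c / 2"
    have nonneg: "0 \<le> z" "0 \<le> v" "0 \<le> w" "0 \<le> u"
      using that by (simp_all add: z_def v_def w_def u_def)
    have "2 * z + v + 2 * w = a" "2 * z + v = b" "2 * z + 2 * v + 2 * w = c" "z + v + w + u = r"
      by (simp_all add: z_def v_def w_def u_def field_simps)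
    then have "4 * upright_gap a b c r \<ge> 0"
      using upright_gap_ravi[of z v w u] nonneg by simp
    then show ?thesis
      by simp
  qed
  consider "b \<le> a" "a \<le> c" | "a \<le> b" "b \<le> c" | "b \<le> c" "c \<le> a"
    | "c \<le> b" "b \<le> a" | "a \<le> c" "c \<le> b" | "c \<le> a" "a \<le> b"
    by linarith
  moreover have "upright_gap b a c r = upright_gap a b c r"
    "upright_gap a c b r = upright_gap a b c r"
    "upright_gap b c a r = upright_gap a b c r" "upright_gap c a b r = upright_gap a b c r"
    "upright_gap c b a r = upright_gap a b c r"
    by (metis upright_gap_commute)+
  ultimately show ?thesis
    using *[of b a c] *[of a b c] *[of b c a] *[of c b a] *[of a c b] *[of c a b] assms
    by cases (simp_all add: add.commute)
qed

theorem mainTheorem8: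
  fixes x :: "nat \<Rightarrow> real ^ 3"
    and \<alpha> \<beta> :: "nat \<Rightarrow> nat \<Rightarrow> complex"
  assumes nondegenerate: "\<not> collinear {x 1, x 2, x 3}"
    and upright: "dist (x 1) (x 4) = dist (x 2) (x 4)" "dist (x 2) (x 4) = dist (x 3) (x 4)"
    and lift: "admissible_lift x \<alpha> \<beta>"
  shows "Re (atiyah_D4 x \<alpha> \<beta>) - 4 * (288 * (tetrahedron_volume x)\<^sup>2)
    \<ge> 64 * edge_product x
      + (\<Sum>(l, i, j, k)\<in>{(1, 2, 3, 4), (2, 1, 3, 4), (3, 1, 2, 4), (4, 1, 2, 3)}.
          (4 + 1 / 4) * dist (x i) (x l) * dist (x j) (x l) * dist (x k) (x l)
          * d3 (dist (x i) (x j)) (dist (x i) (x k)) (dist (x j) (x k)))"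
proof -
  define a b c r where "a = dist (x 2) (x 3)" and "b = dist (x 1) (x 3)"
    and "c = dist (x 1) (x 2)" and "r = dist (x 1) (x 4)"
  have r: "dist (x 1) (x 4) = r" "dist (x 2) (x 4) = r" "dist (x 3) (x 4) = r"
    "dist (x 4) (x 1) = r" "dist (x 4) (x 2) = r" "dist (x 4) (x 3) = r"
    using upright by (simp_all add: r_def dist_commute)
  have abc: "dist (x 2) (x 3) = a" "dist (x 3) (x 2) = a" "dist (x 1) (x 3) = b"
    "dist (x 3) (x 1) = b" "dist (x 1) (x 2) = c" "dist (x 2) (x 1) = c"
    by (simp_all add: a_def b_def c_def dist_commute)
  have four: "{1..4} = {1, 2, 3, 4 :: nat}"
    by auto
  have "x 1 \<noteq> x 2" "x 1 \<noteq> x 3" "x 2 \<noteq> x 3"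
    using nondegenerate by (auto simp: insert_commute)
  \<comment> \<open>If \<open>x 4\<close> were a base vertex, the common distance would be 0 and the
    base vertices would coincide.\<close>
  moreover from this have "x 1 \<noteq> x 4" "x 2 \<noteq> x 4" "x 3 \<noteq> x 4"
    using upright by auto
  ultimately have inj: "inj_on x {1..4}"
    unfolding four by auto
  have tri: "a \<le> b + c" "b \<le> a + c" "c \<le> a + b" "a \<le> 2 * r" "b \<le> 2 * r" "c \<le> 2 * r"
    using dist_triangle[of "x 2" "x 3" "x 1"] dist_triangle[of "x 1" "x 3" "x 2"]
      dist_triangle[of "x 1" "x 2" "x 3"] dist_triangle[of "x 2" "x 3" "x 4"]
      dist_triangle[of "x 1" "x 3" "x 4"] dist_triangle[of "x 1" "x 2" "x 4"]
    unfolding r abc by simp_all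
  have "288 * (tetrahedron_volume x)\<^sup>2 =
      8 * (triple_product (x 1 - x 4) (x 2 - x 4) (x 3 - x 4))\<^sup>2"
    by (simp add: tetrahedron_volume_eq[OF inj] power_divide)
  also have "\<dots> = 8 * r\<^sup>2 * r\<^sup>2 * r\<^sup>2 + 2 * (2 * r\<^sup>2 - c\<^sup>2) * (2 * r\<^sup>2 - b\<^sup>2) * (2 * r\<^sup>2 - a\<^sup>2)
      - 2 * r\<^sup>2 * ((2 * r\<^sup>2 - a\<^sup>2)\<^sup>2 + (2 * r\<^sup>2 - b\<^sup>2)\<^sup>2 + (2 * r\<^sup>2 - c\<^sup>2)\<^sup>2)"
    unfolding triple_product_gram diff_diff_eq2 diff_add_cancel dist_norm[symmetric] r abc
    by Groebner_Basis.algebra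
  finally have vol: "288 * (tetrahedron_volume x)\<^sup>2 = \<dots>" .
  \<comment> \<open>The edge products cancel, and one of the four copies of 288 V^2 cancels against
    the volume term of the formula, which leaves the factor 3.\<close>
  have "upright_gap a b c r = Re (atiyah_D4 x \<alpha> \<beta>) - 4 * (288 * (tetrahedron_volume x)\<^sup>2)
    - (64 * edge_product x
      + (\<Sum>(l, i, j, k)\<in>{(1, 2, 3, 4), (2, 1, 3, 4), (3, 1, 2, 4), (4, 1, 2, 3)}.
          (4 + 1 / 4) * dist (x i) (x l) * dist (x j) (x l) * dist (x k) (x l)
          * d3 (dist (x i) (x j)) (dist (x i) (x k)) (dist (x j) (x k))))"
    unfolding eastwood_norbury[OF inj lift] vol upright_gap_def
    by (simp add: r[simplified] abc[simplified] algebra_simps)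
  with upright_gap_nonneg[OF tri] show ?thesis
    by linarith
qed

end
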